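(* Let $f : \mathbb{R}^n \rightarrow \mathbb{R}$ be locally Lipschitz continuous. Let $(\varepsilon_j)_j$ and $(\delta_j)_j$ be sequences in $\mathbb{R}^{>0}$ with $\varepsilon_j \rightarrow 0$. Let $(x^j)_j$ be the sequence generated by the abstract $\varepsilon$-descent method (described in the context) with these sequences as parameters. Assume that $x^j \rightarrow x^* \in \mathbb{R}^n$, where $x^*$ is a minimum of order $p \in \mathbb{N}$ with constant $\beta > 0$ of $f$ for which $$\liminf_{\xi \in \partial f(x^* + t d'),\, t \searrow 0,\, d' \rightarrow d} \frac{\langle \xi, d' \rangle}{t^{p-1}} \geq \beta \| d \|^p \quad \text{for all } d \in \mathbb{R}^n \setminus \{0\}.$$ (i) If $p = 1$ and $\delta_j \rightarrow \bar{\delta}$ for some $\bar{\delta} < \beta$, then there are $M > 0$ and $N \in \mathbb{N}$ such that $$\| x^j - x^* \| \leq M \varepsilon_j \quad \text{for all } j > N.$$ (ii) If $p \geq 2$, then there are $M > 0$ and $N \in \mathbb{N}$ such that $$\| x^j - x^* \| \leq M \max\left(\varepsilon_j^{\frac{1}{p}}, \delta_j^{\frac{1}{p-1}}\right) \quad \text{for all } j > N.$$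
   Context: $\mathbb{N} = \{1,2,\dots\}$; $\|\cdot\|$ is the Euclidean norm and $\langle\cdot,\cdot\rangle$ the Euclidean inner product on $\mathbb{R}^n$. Clarke subdifferential: for a locally Lipschitz continuous $f$ with set of non-differentiability points $\Omega$, $\partial f(x)$ is the convex hull of the set of all $\xi \in \mathbb{R}^n$ for which there is a sequence $(y^k)_k$ in $\mathbb{R}^n \setminus \Omega$ with $y^k \to x$ and $\nabla f(y^k) \to \xi$. Goldstein $\varepsilon$-subdifferential: for $\varepsilon \geq 0$, $\partial_\varepsilon f(x) := \operatorname{conv}\big(\bigcup_{y \in \bar{B}_\varepsilon(x)} \partial f(y)\big)$, where $\bar{B}_\varepsilon(x) = \{ y \in \mathbb{R}^n : \|y - x\| \leq \varepsilon\}$. This set is compact. Minimum of order $p$: $x^*$ is a minimum of order $p \in \mathbb{N}$ with constant $\beta > 0$ of $f$ if there is an open set $U \subseteq \mathbb{R}^n$ with $x^* \in U$ and $f(x) \geq f(x^* ) + \beta \|x - x^*\|^p$ for all $x \in U$. The limit inferior in the claim is an element of $\mathbb{R} \cup \{-\infty,\infty\}$ and is the infimum of $\liminf_{k\to\infty} \langle \xi^k, d^k\rangle / t_k^{p-1}$ over all sequences with $t_k > 0$, $t_k \to 0$, $d^k \to d$ and $\xi^k \in \partial f(x^* + t_k d^k)$. Sufficient approximation: given $c \in (0,1)$, $\varepsilon, \delta > 0$ and $x \in \mathbb{R}^n$, a nonempty set $W \subseteq \partial_\varepsilon f(x)$ (for which $v := \operatorname{arg\,min}_{\xi \in -\operatorname{conv}(W)}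 \|\xi\|^2$ exists) is a sufficient approximation if $\|v\| \leq \delta$ or $f\big(x + \tfrac{\varepsilon}{\|v\|} v\big) \leq f(x) - c\,\varepsilon \|v\|$. Abstract $\varepsilon$-descent method. Input: initial point $x^0 \in \mathbb{R}^n$, sequences $(\varepsilon_j)_j, (\delta_j)_j$ in $\mathbb{R}^{>0}$, parameter $c \in (0,1)$. Step 1: Initialize $i = 0$, $j = 1$, $x^{1,0} = x^0$. Step 2: Compute $v = \operatorname{arg\,min}_{\xi \in -\operatorname{conv}(W)} \|\xi\|^2$ for a sufficient approximation $W \subseteq \partial_{\varepsilon_j} f(x^{j,i})$ (with respect to $c$, $\varepsilon_j$, $\delta_j$ at $x^{j,i}$). Step 3: If $\|v\| \leq \delta_j$, set $x^{j+1,0} = x^{j,i}$, $j = j+1$, $i = 0$ and go to Step 2. Step 4: Otherwise, choose some $t \geq \varepsilon_j/\|v\|$ with $f(x^{j,i} + t v) \leq f(x^{j,i}) - c\,t\|v\|^2$, set $x^{j,i+1} = x^{j,i} + t v$, $i = i+1$ and go to Step 2. For each $j$, $N_j \in \mathbb{N} \cup \{0\}$ denotes the final value of $i$ before $i$ is reset to $0$ and $j$ is increased (in Step 3). The sequence $(x^j)_j$ generated by the method is $x^j := x^{j,N_j} = x^{j+1,0}$, $j \in \mathbb{N}$ (it is implicit that all $N_j$ are finite, so that the whole sequence is defined). *)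

theory Defs
  imports "HOL-Analysis.Analysis"
begin

definition locally_lipschitz :: "(real^'n \<Rightarrow> real) \<Rightarrow> bool" where
  "locally_lipschitz f \<longleftrightarrow> (\<forall>x. \<exists>r>0. \<exists>L. L-lipschitz_on (ball x r) f)"

text \<open>\<open>GDERIV f y :> g\<close> states both that \<open>f\<close> is differentiable at \<open>y\<close> and that its gradient
  there is \<open>g\<close>.\<close>

definition clarke_subdiff :: "(real^'n \<Rightarrow> real) \<Rightarrow> real^'n \<Rightarrow> (real^'n) set" where
  "clarke_subdiff f x = convex hull
     {\<xi>. \<exists>y g. (\<forall>k::nat. GDERIV f (y k) :> g k) \<and> y \<longlonglongrightarrow> x \<and> g \<longlonglongrightarrow> \<xi>}"

definition goldstein_subdiff :: "(real^'n \<Rightarrow> real) \<Rightarrow> real \<Rightarrow> real^'n \<Rightarrow> (real^'n) set" where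
  "goldstein_subdiff f \<epsilon> x = convex hull (\<Union>y\<in>cball x \<epsilon>. clarke_subdiff f y)"

definition minimum_of_order ::
    "(real^'n \<Rightarrow> real) \<Rightarrow> real^'n \<Rightarrow> nat \<Rightarrow> real \<Rightarrow> bool" where
  "minimum_of_order f xs p \<beta> \<longleftrightarrow> p \<ge> 1 \<and> \<beta> > 0 \<and>
     (\<exists>U. open U \<and> xs \<in> U \<and> (\<forall>x\<in>U. f x \<ge> f xs + \<beta> * norm (x - xs) ^ p))"

text \<open>The limit inferior of \<open>\<langle>\<xi>, d'\<rangle> / t\<^sup>p\<^sup>-\<^sup>1\<close> over \<open>\<xi> \<in> \<partial>f(x\<^sup>* + t d')\<close>, as \<open>t\<close> decreases to \<open>0\<close> and
  \<open>d'\<close> tends to \<open>d\<close>: an extended real, taken as the infimum over all admissible sequences.\<close>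

definition subdiff_liminf ::
    "(real^'n \<Rightarrow> real) \<Rightarrow> real^'n \<Rightarrow> nat \<Rightarrow> real^'n \<Rightarrow> ereal" where
  "subdiff_liminf f xs p d = Inf
     {liminf (\<lambda>k. ereal (inner (\<xi> k) (d' k) / t k ^ (p - 1))) | t d' \<xi>.
        (\<forall>k. t k > 0) \<and> t \<longlonglongrightarrow> 0 \<and> d' \<longlonglongrightarrow> d \<and>
        (\<forall>k. \<xi> k \<in> clarke_subdiff f (xs + t k *\<^sub>R d' k))}"

definition descent_direction :: "(real^'n) set \<Rightarrow> real^'n \<Rightarrow> bool" where
  "descent_direction W v \<longleftrightarrow>
     is_arg_min (\<lambda>\<xi>. (norm \<xi>)\<^sup>2) (\<lambda>\<xi>. \<xi> \<in> uminus ` (convex hull W)) v"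

text \<open>The minimizer \<open>v\<close> need not exist for arbitrary \<open>W\<close>, but it is unique when it does, since
  the norm is strictly convex.\<close>

definition sufficient_approximation ::
    "(real^'n \<Rightarrow> real) \<Rightarrow> real \<Rightarrow> real \<Rightarrow> real \<Rightarrow> real^'n \<Rightarrow> (real^'n) set \<Rightarrow> bool" where
  "sufficient_approximation f c \<epsilon> \<delta> x W \<longleftrightarrow>
     W \<noteq> {} \<and> W \<subseteq> goldstein_subdiff f \<epsilon> x \<and>
     (\<exists>v. descent_direction W v \<and>
        (norm v \<le> \<delta> \<or> f (x + (\<epsilon> / norm v) *\<^sub>R v) \<le> f x - c * \<epsilon> * norm v))"

text \<open>A run of the method with all inner loops finite. \<open>X j i\<close> is the iterate \<open>x\<^sup>j\<^sup>,\<^sup>i\<close> and \<open>N j\<close> the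
  number of inner steps taken before \<open>j\<close> is increased. The outer index starts at \<open>1\<close>, so index
  \<open>0\<close> of \<open>\<epsilon>\<close>, \<open>\<delta>\<close>, \<open>X\<close> and \<open>N\<close> is unused. The choices of \<open>W\<close> and of the step length \<open>t\<close> are
  left open, so there can be many runs for the same input.\<close>

definition descent_step ::
    "(real^'n \<Rightarrow> real) \<Rightarrow> real \<Rightarrow> real \<Rightarrow> real \<Rightarrow> real^'n \<Rightarrow> real^'n \<Rightarrow> bool" where
  "descent_step f c \<epsilon> \<delta> x x' \<longleftrightarrow>
     (\<exists>W v t. sufficient_approximation f c \<epsilon> \<delta> x W \<and> descent_direction W v \<and>
        \<not> norm v \<le> \<delta> \<and>
        t \<ge> \<epsilon> / norm v \<and> f (x + t *\<^sub>R v) \<le> f x - c * t * (norm v)\<^sup>2 \<and>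
        x' = x + t *\<^sub>R v)"

definition inner_stop ::
    "(real^'n \<Rightarrow> real) \<Rightarrow> real \<Rightarrow> real \<Rightarrow> real \<Rightarrow> real^'n \<Rightarrow> bool" where
  "inner_stop f c \<epsilon> \<delta> x \<longleftrightarrow>
     (\<exists>W v. sufficient_approximation f c \<epsilon> \<delta> x W \<and> descent_direction W v \<and> norm v \<le> \<delta>)"

definition descent_run ::
    "(real^'n \<Rightarrow> real) \<Rightarrow> real \<Rightarrow> (nat \<Rightarrow> real) \<Rightarrow> (nat \<Rightarrow> real) \<Rightarrow> real^'n \<Rightarrow>
     (nat \<Rightarrow> nat \<Rightarrow> real^'n) \<Rightarrow> (nat \<Rightarrow> nat) \<Rightarrow> bool" where
  "descent_run f c \<epsilon> \<delta> x0 X N \<longleftrightarrow> X 1 0 = x0 \<and>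
     (\<forall>j\<ge>1. (\<forall>i<N j. descent_step f c (\<epsilon> j) (\<delta> j) (X j i) (X j (Suc i))) \<and>
            inner_stop f c (\<epsilon> j) (\<delta> j) (X j (N j)) \<and>
            X (Suc j) 0 = X j (N j))"

definition generated_by_descent ::
    "(real^'n \<Rightarrow> real) \<Rightarrow> real \<Rightarrow> (nat \<Rightarrow> real) \<Rightarrow> (nat \<Rightarrow> real) \<Rightarrow> real^'n \<Rightarrow>
     (nat \<Rightarrow> real^'n) \<Rightarrow> bool" where
  "generated_by_descent f c \<epsilon> \<delta> x0 x \<longleftrightarrow>
     (\<exists>X N. descent_run f c \<epsilon> \<delta> x0 X N \<and> (\<forall>j\<ge>1. x j = X j (N j)))"

end

theory Submission
  imports Defs
begin

(* Since the unit sphere is compact, the liminf condition holds uniformly near xs: every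
   subgradient \<xi> at y satisfies <\<xi>, y - xs> >= \<beta>' |y - xs|^p for a given \<beta>' < \<beta>. Replacing y by
   a point x with |y - x| <= \<epsilon> costs at most L \<epsilon> on the left, so for a Goldstein subgradient g at x
   with |g| <= \<delta> and r = |x - xs| one gets \<beta>' (r - \<epsilon>)^p <= L \<epsilon> + \<delta> r. Both rates are read off
   this inequality. *)

section \<open>Norm bounds for Clarke subgradients\<close>

text \<open>Along its own gradient \<open>g\<close>, \<open>f\<close> has directional derivative
  |g|^2, while the difference quotients in that direction are at most L |g|. Comparing the two and
  cancelling |g| gives the bound.\<close>

lemma GDERIV_norm_le_lipschitz:
  fixes f :: "'a::real_inner \<Rightarrow> real"
  assumes lip: "L-lipschitz_on S f" and "open S" "y \<in> S" and g: "GDERIV f y :> g"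
  shows "norm g \<le> L"
proof (cases "g = 0")
  case True
  then show ?thesis using lipschitz_on_nonneg[OF lip] by simp
next
  case False
  have "((\<lambda>t. y + t *\<^sub>R g) has_derivative (\<lambda>t. t *\<^sub>R g)) (at (0::real))"
    by (auto intro!: derivative_eq_intros)
  moreover have "(f has_derivative (\<lambda>h. inner h g)) (at (y + 0 *\<^sub>R g))"
    using g by (simp add: gderiv_def)
  ultimately have "((\<lambda>t. f (y + t *\<^sub>R g)) has_derivative (\<lambda>t. inner (t *\<^sub>R g) g)) (at 0)"
    by (rule has_derivative_compose)
  then have "((\<lambda>t. f (y + t *\<^sub>R g)) has_field_derivative (norm g)\<^sup>2) (at 0)"
    by (simp add: has_field_derivative_def power2_norm_eq_inner mult.commute[of _ "inner g g"])
  then have lim: "((\<lambda>t. (f (y + t *\<^sub>R g) - f y) / t) \<longlongrightarrow> (norm g)\<^sup>2) (at 0)"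
    by (simp add: DERIV_def)
  have "((\<lambda>t. y + t *\<^sub>R g) \<longlongrightarrow> y + 0 *\<^sub>R g) (at (0::real))"
    by (intro tendsto_intros)
  then have "\<forall>\<^sub>F t in at (0::real). y + t *\<^sub>R g \<in> S"
    using topological_tendstoD[of _ y, OF _ \<open>open S\<close> \<open>y \<in> S\<close>] by simp
  then have "\<forall>\<^sub>F t in at (0::real). (f (y + t *\<^sub>R g) - f y) / t \<le> L * norm g"
  proof (eventually_elim, goal_cases)
    case (1 t)
    have "\<bar>f (y + t *\<^sub>R g) - f y\<bar> \<le> L * \<bar>t\<bar> * norm g"
      using lipschitz_onD[OF lip 1 \<open>y \<in> S\<close>] by (simp add: dist_norm mult.assoc)
    \<comment> \<open>At \<open>t = 0\<close> the quotient is 0 by the convention for division, so L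
      >= 0 settles that case.\<close>
    then have "\<bar>(f (y + t *\<^sub>R g) - f y) / t\<bar> \<le> L * norm g"
      using lipschitz_on_nonneg[OF lip] by (cases "t = 0") (auto simp: field_simps)
    then show ?case by linarith
  qed
  from tendsto_upperbound[OF lim this] have "(norm g)\<^sup>2 \<le> L * norm g"
    by simp
  then show ?thesis using False by (simp add: power2_eq_square)
qed

text \<open>The bound holds for gradients at points near \<open>x\<close>, passes to their limits,
  and survives the convex hull because a ball is convex.\<close>

lemma clarke_subdiff_norm_le:
  assumes "L-lipschitz_on S f" "open S" "x \<in> S" "\<xi> \<in> clarke_subdiff f x"
  shows "norm \<xi> \<le> L"
proof -
  have "norm \<zeta> \<le> L" if y: "\<forall>k::nat. GDERIV f (y k) :> g k" "y \<longlonglongrightarrow> x" "g \<longlonglongrightarrow> \<zeta>" for y g \<zeta>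
  proof (rule tendsto_upperbound[OF tendsto_norm[OF y(3)]])
    have "\<forall>\<^sub>F k in sequentially. y k \<in> S"
      using topological_tendstoD[OF y(2) assms(2,3)] .
    then show "\<forall>\<^sub>F k in sequentially. norm (g k) \<le> L"
      by eventually_elim (use GDERIV_norm_le_lipschitz[OF assms(1,2)] y(1) in blast)
  qed simp
  then have "clarke_subdiff f x \<subseteq> cball 0 L"
    unfolding clarke_subdiff_def by (intro hull_minimal) auto
  then show ?thesis using assms(4) by auto
qed

section \<open>Goldstein subgradients\<close>

text \<open>Half-spaces are convex, so a linear lower bound need only be checked on the Clarke
  subgradients at each single point of the ball.\<close>

lemma inner_goldstein_subdiff_ge:
  assumes "\<And>y \<xi>. y \<in> cball x \<epsilon> \<Longrightarrow> \<xi> \<in> clarke_subdiff f y \<Longrightarrow> a \<le> inner \<xi> u"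
    and "g \<in> goldstein_subdiff f \<epsilon> x"
  shows "a \<le> inner g u"
proof -
  have "goldstein_subdiff f \<epsilon> x \<subseteq> {\<xi>. inner u \<xi> \<ge> a}"
    unfolding goldstein_subdiff_def
    by (intro hull_minimal convex_halfspace_ge) (use assms(1) in \<open>auto simp: inner_commute\<close>)
  then show ?thesis using assms(2) by (auto simp: inner_commute)
qed

text \<open>This is what the stopping test contributes to the estimates. The vector -v lies in the
  hull of \<open>W\<close>, which stays inside the convex Goldstein subdifferential.\<close>

lemma inner_stop_goldstein_subdiff:
  assumes "inner_stop f c \<epsilon> \<delta> x"
  obtains g where "g \<in> goldstein_subdiff f \<epsilon> x" "norm g \<le> \<delta>"
proof -
  obtain W v where W: "W \<subseteq> goldstein_subdiff f \<epsilon> x"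
    and v: "v \<in> uminus ` (convex hull W)" "norm v \<le> \<delta>"
    using assms
    unfolding inner_stop_def sufficient_approximation_def descent_direction_def is_arg_min_def
    by blast
  have "convex hull W \<subseteq> goldstein_subdiff f \<epsilon> x"
    using W by (intro hull_minimal) (auto simp: goldstein_subdiff_def)
  then show thesis using v that[of "- v"] by auto
qed

section \<open>Uniform consequences of the liminf condition\<close>

text \<open>Otherwise there are violating points tending to \<open>xs\<close>. Their normalized
  directions have a subsequence converging to a unit vector \<open>l\<close>, and along it the
  quotients stay at most \<beta>', so the limit inferior at \<open>l\<close> falls below
  \<beta>.\<close>

lemma subdiff_liminf_uniform:
  fixes f :: "real^'n \<Rightarrow> real"
  assumes p: "p \<ge> 1" and \<beta>': "\<beta>' < \<beta>"
    and lim: "\<And>d. d \<noteq> 0 \<Longrightarrow> subdiff_liminf f xs p d \<ge> ereal (\<beta> * norm d ^ p)"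
  obtains \<rho> where "\<rho> > 0"
    "\<And>y \<xi>. norm (y - xs) < \<rho> \<Longrightarrow> \<xi> \<in> clarke_subdiff f y \<Longrightarrow>
       \<beta>' * norm (y - xs) ^ p \<le> inner \<xi> (y - xs)"
proof -
  have "\<exists>\<rho>>0. \<forall>y \<xi>. norm (y - xs) < \<rho> \<and> \<xi> \<in> clarke_subdiff f y \<longrightarrow>
       \<beta>' * norm (y - xs) ^ p \<le> inner \<xi> (y - xs)"
  proof (rule ccontr)
    assume "\<not> ?thesis"
    then have "\<exists>y \<xi>. norm (y - xs) < inverse (real (Suc k)) \<and> \<xi> \<in> clarke_subdiff f y \<and>
       inner \<xi> (y - xs) < \<beta>' * norm (y - xs) ^ p" for k
      by (auto simp: not_le dest!: spec[of _ "inverse (real (Suc k))"])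
    then obtain y \<xi> where y: "\<And>k. norm (y k - xs) < inverse (real (Suc k))"
      and \<xi>: "\<And>k. \<xi> k \<in> clarke_subdiff f (y k)"
      and less: "\<And>k. inner (\<xi> k) (y k - xs) < \<beta>' * norm (y k - xs) ^ p"
      by metis
    define t where "t k = norm (y k - xs)" for k
    define d where "d k = (y k - xs) /\<^sub>R t k" for k
    \<comment> \<open>At \<open>xs\<close> both sides of the strict inequality \<open>less\<close>
      would be 0, since p >= 1. Hence the directions are well defined.\<close>
    have ne: "y k \<noteq> xs" for k
      using less[of k] p by (auto simp: power_0_left)
    have tpos: "t k > 0" for k
      using ne by (simp add: t_def)
    have t0: "t \<longlonglongrightarrow> 0"
      by (rule tendsto_sandwich[OF _ _ tendsto_const LIMSEQ_inverse_real_of_nat])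
        (use y in \<open>auto simp: t_def intro!: always_eventually less_imp_le\<close>)
    have diff: "y k - xs = t k *\<^sub>R d k" for k
      using tpos[of k] by (simp add: d_def)
    have \<xi>_d: "\<xi> k \<in> clarke_subdiff f (xs + t k *\<^sub>R d k)" for k
      using \<xi>[of k] by (simp flip: diff)
    have "d k \<in> sphere 0 1" for k
      using tpos[of k] by (simp add: d_def) (simp add: t_def)
    then obtain l r where l: "l \<in> sphere 0 1" and r: "strict_mono r" "(d \<circ> r) \<longlonglongrightarrow> l"
      using compact_sphere[of "0::real^'n" 1] unfolding compact_def by metis
    \<comment> \<open>One factor t comes out of the inner product, which leaves the power p - 1 on
      the right.\<close>
    have quot: "inner (\<xi> k) (d k) / t k ^ (p - 1) \<le> \<beta>'" for k
    proof -
      have "inner (\<xi> k) (t k *\<^sub>R d k) < \<beta>' * t k ^ p"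
        using less[of k] by (simp flip: t_def diff)
      also have "\<beta>' * t k ^ p = t k * (\<beta>' * t k ^ (p - 1))"
        using p by (simp add: power_eq_if)
      finally have "inner (\<xi> k) (d k) < \<beta>' * t k ^ (p - 1)"
        using tpos[of k] by simp
      then show ?thesis using tpos[of k] by (simp add: pos_divide_le_eq)
    qed
    have "(t \<circ> r) \<longlonglongrightarrow> 0"
      using LIMSEQ_subseq_LIMSEQ[OF t0 r(1)] .
    \<comment> \<open>The subsequences along \<open>r\<close> are admissible in the infimum that
      defines the limit inferior at \<open>l\<close>.\<close>
    then have "subdiff_liminf f xs p l \<le>
        liminf (\<lambda>k. ereal (inner ((\<xi> \<circ> r) k) ((d \<circ> r) k) / (t \<circ> r) k ^ (p - 1)))"
      unfolding subdiff_liminf_def using r(2) tpos \<xi>_d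
      by (intro Inf_lower CollectI exI[of _ "t \<circ> r"] exI[of _ "d \<circ> r"] exI[of _ "\<xi> \<circ> r"]) auto
    also have "\<dots> \<le> liminf (\<lambda>k::nat. ereal \<beta>')"
      by (rule Liminf_mono) (use quot in auto)
    also have "\<dots> = ereal \<beta>'"
      by (simp add: Liminf_const)
    finally have "subdiff_liminf f xs p l \<le> ereal \<beta>'" .
    moreover have "ereal \<beta> \<le> subdiff_liminf f xs p l"
      using lim[of l] l by force
    ultimately have "ereal \<beta> \<le> ereal \<beta>'"
      by (rule order_trans[rotated])
    then show False
      using \<beta>' by simp
  qed
  then show thesis using that by blast
qed

text \<open>For \<xi> at y in the ball around x, split <\<xi>, x - xs> into <\<xi>, y - xs> +
  <\<xi>, x - y>. The uniform estimate bounds the first term from below, and the Lipschitz constant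
  bounds the second. Cauchy-Schwarz for \<open>g\<close> supplies the upper bound.\<close>

lemma goldstein_subdiff_distance_bound:
  fixes f :: "real^'n \<Rightarrow> real"
  assumes "locally_lipschitz f" and p: "p \<ge> 1" and \<beta>': "0 \<le> \<beta>'" "\<beta>' < \<beta>"
    and lim: "\<And>d. d \<noteq> 0 \<Longrightarrow> subdiff_liminf f xs p d \<ge> ereal (\<beta> * norm d ^ p)"
  obtains \<rho> L where "\<rho> > 0" "L \<ge> 0"
    "\<And>x \<epsilon> \<delta> g. norm (x - xs) + \<epsilon> < \<rho> \<Longrightarrow> \<epsilon> \<le> norm (x - xs) \<Longrightarrow>
       g \<in> goldstein_subdiff f \<epsilon> x \<Longrightarrow> norm g \<le> \<delta> \<Longrightarrow>
       \<beta>' * (norm (x - xs) - \<epsilon>) ^ p \<le> L * \<epsilon> + \<delta> * norm (x - xs)"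
proof -
  obtain \<rho>1 where \<rho>1: "\<rho>1 > 0"
    "\<And>y \<xi>. norm (y - xs) < \<rho>1 \<Longrightarrow> \<xi> \<in> clarke_subdiff f y \<Longrightarrow>
       \<beta>' * norm (y - xs) ^ p \<le> inner \<xi> (y - xs)"
    using subdiff_liminf_uniform[OF p \<beta>'(2) lim] by blast
  obtain \<rho>2 L where \<rho>2: "\<rho>2 > 0" and L: "L-lipschitz_on (ball xs \<rho>2) f"
    using assms(1) unfolding locally_lipschitz_def by blast
  have L0: "L \<ge> 0" using L by (rule lipschitz_on_nonneg)
  \<comment> \<open>The radius keeps the whole ball \<open>cball x \<epsilon>\<close> inside both
    neighbourhoods: that of the uniform estimate and that of the Lipschitz bound.\<close>
  show thesis
  proof (rule that[of "min \<rho>1 \<rho>2" L])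
    fix x \<epsilon> \<delta> g
    assume near: "norm (x - xs) + \<epsilon> < min \<rho>1 \<rho>2" and le: "\<epsilon> \<le> norm (x - xs)"
      and g: "g \<in> goldstein_subdiff f \<epsilon> x" "norm g \<le> \<delta>"
    have "\<beta>' * (norm (x - xs) - \<epsilon>) ^ p - L * \<epsilon> \<le> inner g (x - xs)"
    proof (rule inner_goldstein_subdiff_ge[OF _ g(1)])
      fix y \<xi>
      assume y: "y \<in> cball x \<epsilon>" and \<xi>: "\<xi> \<in> clarke_subdiff f y"
      have xy: "norm (x - y) \<le> \<epsilon>" using y by (simp add: dist_norm)
      have "norm (y - xs) \<le> norm (x - xs) + norm (x - y)"
        using norm_triangle_ineq4[of "x - xs" "x - y"] by simp
      then have ny: "norm (y - xs) < \<rho>1" "norm (y - xs) < \<rho>2" using xy near by auto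
      have low: "norm (x - xs) - \<epsilon> \<le> norm (y - xs)"
        using norm_triangle_ineq[of "x - y" "y - xs"] xy by simp
      have "norm \<xi> \<le> L"
        using clarke_subdiff_norm_le[OF L open_ball _ \<xi>] ny(2)
        by (simp add: dist_norm norm_minus_commute)
      then have "norm \<xi> * norm (x - y) \<le> L * \<epsilon>" using xy L0 by (intro mult_mono) auto
      then have "- (L * \<epsilon>) \<le> inner \<xi> (x - y)"
        using Cauchy_Schwarz_ineq2[of \<xi> "x - y"] by linarith
      \<comment> \<open>The condition \<epsilon> <= |x - xs| makes the smaller base nonnegative, so
        the power is monotone here.\<close>
      moreover have "\<beta>' * (norm (x - xs) - \<epsilon>) ^ p \<le> \<beta>' * norm (y - xs) ^ p"
        using low le \<beta>'(1) by (intro mult_left_mono power_mono) auto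
      ultimately show "\<beta>' * (norm (x - xs) - \<epsilon>) ^ p - L * \<epsilon> \<le> inner \<xi> (x - xs)"
        using \<rho>1(2)[OF ny(1) \<xi>] by (simp add: inner_diff_right)
    qed
    moreover have "inner g (x - xs) \<le> \<delta> * norm (x - xs)"
      using norm_cauchy_schwarz[of g "x - xs"] mult_right_mono[OF g(2) norm_ge_zero[of "x - xs"]]
      by linarith
    ultimately show "\<beta>' * (norm (x - xs) - \<epsilon>) ^ p \<le> L * \<epsilon> + \<delta> * norm (x - xs)"
      by linarith
  qed (use \<rho>1(1) \<rho>2 L0 in auto)
qed

section \<open>From the power inequality to a rate\<close>

lemma le_powr_if_power_le:
  fixes r a C :: real
  assumes "r > 0" "n > 0" and le: "r ^ n \<le> C * a"
  shows "r \<le> C powr (1 / real n) * a powr (1 / real n)"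
proof -
  have "r = (r ^ n) powr (1 / real n)"
    using assms(1,2) by (simp flip: powr_realpow add: powr_powr)
  also have "\<dots> \<le> (C * a) powr (1 / real n)"
    using assms by (intro powr_mono2) auto
  also have "\<dots> = C powr (1 / real n) * a powr (1 / real n)"
    by (rule powr_mult)
  finally show ?thesis .
qed

text \<open>If r > 2e, then r - e >= r/2, so r^p is bounded by a multiple of the larger of L e and d
  r. The first gives the rate in e; in the second a factor r cancels and gives the rate in
  d.\<close>

lemma distance_rate_of_power_inequality:
  fixes b L :: real
  assumes p: "p \<ge> 2" and b: "b > 0"
  obtains M where "M > 0"
    "\<And>r e d. 0 < e \<Longrightarrow> e \<le> 1 \<Longrightarrow> 0 < d \<Longrightarrow> (e \<le> r \<Longrightarrow> b * (r - e) ^ p \<le> L * e + d * r) \<Longrightarrow>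
       r \<le> M * max (e powr (1 / real p)) (d powr (1 / (real p - 1)))"
proof -
  \<comment> \<open>The factor 2^p comes from (r/2)^p, and the remaining 2 from replacing the sum L
    e + d r by twice its larger term.\<close>
  define K where "K = 2 ^ (p + 1) / b"
  define A where "A = (K * L) powr (1 / real p)"
  define B where "B = K powr (1 / (real p - 1))"
  have nn: "A \<ge> 0" "B \<ge> 0" by (auto simp: A_def B_def)
  show thesis
  proof (rule that[of "2 + A + B"])
    fix r e d :: real
    assume e: "0 < e" "e \<le> 1" and d: "0 < d"
      and ineq: "e \<le> r \<Longrightarrow> b * (r - e) ^ p \<le> L * e + d * r"
    let ?m = "max (e powr (1 / real p)) (d powr (1 / (real p - 1)))"
    have m0: "?m \<ge> 0" by (simp add: le_max_iff_disj)
    consider (near) "r \<le> 2 * e" | (eps) "r > 2 * e" "d * r \<le> L * e"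
      | (del) "r > 2 * e" "L * e \<le> d * r"
      by linarith
    then have "r \<le> 2 * ?m \<or> r \<le> A * ?m \<or> r \<le> B * ?m"
    proof cases
      case near
      \<comment> \<open>For e <= 1, lowering the exponent from 1 to 1/p can only increase the
        power.\<close>
      have "e = e powr 1" using e by simp
      also have "\<dots> \<le> e powr (1 / real p)" using e p by (intro powr_mono') auto
      finally have "e \<le> ?m" by simp
      then show ?thesis using near by simp
    next
      case eps
      then have "b * (r / 2) ^ p \<le> b * (r - e) ^ p"
        using e b by (intro mult_left_mono power_mono) auto
      also have "\<dots> \<le> 2 * (L * e)" using ineq eps e by simp
      finally have "r ^ p \<le> K * L * e"
        using b by (simp add: K_def field_simps)
      from le_powr_if_power_le[OF _ _ this] have "r \<le> A * e powr (1 / real p)"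
        using eps e p by (simp add: A_def)
      also have "\<dots> \<le> A * ?m" using nn by (intro mult_left_mono) auto
      finally show ?thesis by simp
    next
      case del
      then have r0: "r > 0" using e by linarith
      have "b * (r / 2) ^ p \<le> b * (r - e) ^ p"
        using del e b by (intro mult_left_mono power_mono) auto
      also have "\<dots> \<le> 2 * (d * r)" using ineq del e by simp
      finally have "r ^ p \<le> K * d * r"
        using b by (simp add: K_def field_simps)
      \<comment> \<open>Cancelling r leaves the exponent p - 1, which is positive since p >= 2, so a
        root can be taken.\<close>
      then have "r ^ (p - 1) \<le> K * d"
        using r0 p by (simp add: power_eq_if)
      from le_powr_if_power_le[OF r0 _ this] have "r \<le> B * d powr (1 / (real p - 1))"
        using p by (simp add: B_def of_nat_diff)
      also have "\<dots> \<le> B * ?m" using nn by (intro mult_left_mono) auto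
      finally show ?thesis by simp
    qed
    then show "r \<le> (2 + A + B) * ?m"
      using m0 mult_nonneg_nonneg[OF nn(1) m0] mult_nonneg_nonneg[OF nn(2) m0]
      by (auto simp: distrib_right)
  qed (use nn in auto)
qed

section \<open>The rates for the descent method\<close>

theorem corollary2:
  fixes f :: "real^'n \<Rightarrow> real"
    and \<epsilon> \<delta> :: "nat \<Rightarrow> real"
    and c \<beta> :: real
    and x :: "nat \<Rightarrow> real^'n"
    and x0 xs :: "real^'n"
    and p :: nat
  assumes "locally_lipschitz f"
    and "0 < c" "c < 1"
    and "\<And>j. j \<ge> 1 \<Longrightarrow> \<epsilon> j > 0"
    and "\<And>j. j \<ge> 1 \<Longrightarrow> \<delta> j > 0"
    and "\<epsilon> \<longlonglongrightarrow> 0"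
    and "generated_by_descent f c \<epsilon> \<delta> x0 x"
    and "x \<longlonglongrightarrow> xs"
    and "minimum_of_order f xs p \<beta>"
    and "\<And>d. d \<noteq> 0 \<Longrightarrow> subdiff_liminf f xs p d \<ge> ereal (\<beta> * norm d ^ p)"
  shows "(\<forall>\<delta>'. p = 1 \<and> \<delta> \<longlonglongrightarrow> \<delta>' \<and> \<delta>' < \<beta> \<longrightarrow>
            (\<exists>M>0. \<exists>N\<ge>1. \<forall>j>N. norm (x j - xs) \<le> M * \<epsilon> j)) \<and>
         (p \<ge> 2 \<longrightarrow>
            (\<exists>M>0. \<exists>N\<ge>1. \<forall>j>N. norm (x j - xs)
               \<le> M * max (\<epsilon> j powr (1 / real p)) (\<delta> j powr (1 / (real p - 1)))))"
proof -
  have p1: "p \<ge> 1" and \<beta>: "\<beta> > 0"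
    using assms(9) by (auto simp: minimum_of_order_def)
  have stop: "inner_stop f c (\<epsilon> j) (\<delta> j) (x j)" if "j \<ge> 1" for j
    using assms(7) that unfolding generated_by_descent_def descent_run_def by metis
  \<comment> \<open>Both |x^j - xs| and \<epsilon>_j tend to 0, so the local inequality applies to
    all late iterates. The constant \<open>b\<close> stays free because the two claims choose it
    differently.\<close>
  have key: "\<exists>L\<ge>0. \<forall>\<^sub>F j in sequentially. \<epsilon> j \<le> norm (x j - xs) \<longrightarrow>
      b * (norm (x j - xs) - \<epsilon> j) ^ p \<le> L * \<epsilon> j + \<delta> j * norm (x j - xs)"
    if b: "0 \<le> b" "b < \<beta>" for b
  proof -
    obtain \<rho> L where \<rho>: "\<rho> > 0" "L \<ge> 0"
      "\<And>x \<epsilon> \<delta> g. norm (x - xs) + \<epsilon> < \<rho> \<Longrightarrow> \<epsilon> \<le> norm (x - xs) \<Longrightarrow>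
       g \<in> goldstein_subdiff f \<epsilon> x \<Longrightarrow> norm g \<le> \<delta> \<Longrightarrow>
       b * (norm (x - xs) - \<epsilon>) ^ p \<le> L * \<epsilon> + \<delta> * norm (x - xs)"
      using goldstein_subdiff_distance_bound[OF assms(1) p1 b assms(10)] by blast
    have "(\<lambda>j. norm (x j - xs) + \<epsilon> j) \<longlonglongrightarrow> norm (xs - xs) + 0"
      by (intro tendsto_intros assms)
    then have "\<forall>\<^sub>F j in sequentially. norm (x j - xs) + \<epsilon> j < \<rho>"
      using order_tendstoD(2) \<rho>(1) by fastforce
    then have "\<forall>\<^sub>F j in sequentially. \<epsilon> j \<le> norm (x j - xs) \<longrightarrow>
      b * (norm (x j - xs) - \<epsilon> j) ^ p \<le> L * \<epsilon> j + \<delta> j * norm (x j - xs)"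
      \<comment> \<open>The stopping test is available only from the first outer index, 1,
        onwards.\<close>
      using eventually_ge_at_top[of 1]
    proof eventually_elim
      case (elim j)
      obtain g where "g \<in> goldstein_subdiff f (\<epsilon> j) (x j)" "norm g \<le> \<delta> j"
        using inner_stop_goldstein_subdiff[OF stop[OF elim(2)]] .
      then show ?case using \<rho>(3)[OF elim(1)] by blast
    qed
    then show ?thesis using \<rho>(2) by blast
  qed
  have fromN: "\<exists>N\<ge>1. \<forall>j>N. P j" if "\<forall>\<^sub>F j in sequentially. P j" for P :: "nat \<Rightarrow> bool"
  proof -
    obtain N where "\<And>j. j \<ge> N \<Longrightarrow> P j"
      using \<open>eventually P sequentially\<close> unfolding eventually_sequentially by blast
    then show ?thesis by (intro exI[of _ "max 1 N"]) auto
  qed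
  show ?thesis
  proof (intro conjI allI impI)
    fix \<delta>'
    assume "p = 1 \<and> \<delta> \<longlonglongrightarrow> \<delta>' \<and> \<delta>' < \<beta>"
    then have p: "p = 1" and \<delta>': "\<delta> \<longlonglongrightarrow> \<delta>'" "\<delta>' < \<beta>" by auto
    \<comment> \<open>Two intermediate constants: \<delta>_j is eventually below \<open>s\<close>,
      and \<open>b > s\<close> lets the term s |x^j - xs| be absorbed on the left.\<close>
    obtain s where s: "max 0 \<delta>' < s" "s < \<beta>" using dense[of "max 0 \<delta>'" \<beta>] \<beta> \<delta>'(2) by auto
    obtain b where b: "s < b" "b < \<beta>" using dense[OF s(2)] by auto
    obtain L where L: "L \<ge> 0" "\<forall>\<^sub>F j in sequentially. \<epsilon> j \<le> norm (x j - xs) \<longrightarrow>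
      b * (norm (x j - xs) - \<epsilon> j) ^ p \<le> L * \<epsilon> j + \<delta> j * norm (x j - xs)"
      using key[of b] b s by auto
    \<comment> \<open>The 1 covers |x^j - xs| < \<epsilon>_j. The fraction comes from solving b (r -
      \<epsilon>_j) <= L \<epsilon>_j + s r for r.\<close>
    define M where "M = 1 + (L + b) / (b - s)"
    have M: "M > 0" "M \<ge> 1" using L b s by (auto simp: M_def add_pos_nonneg)
    have "\<forall>\<^sub>F j in sequentially. \<delta> j < s"
      using order_tendstoD(2)[OF \<delta>'(1)] s by simp
    then have "\<forall>\<^sub>F j in sequentially. norm (x j - xs) \<le> M * \<epsilon> j"
      using L(2) eventually_ge_at_top[of 1]
    proof eventually_elim
      case (elim j)
      have e: "\<epsilon> j > 0" using assms(4) elim by simp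
      show ?case
      proof (cases "\<epsilon> j \<le> norm (x j - xs)")
        case False
        then show ?thesis using M mult_right_mono[OF M(2), of "\<epsilon> j"] e by linarith
      next
        case True
        have "b * (norm (x j - xs) - \<epsilon> j) \<le> L * \<epsilon> j + s * norm (x j - xs)"
          using elim(1,2) True p mult_right_mono[of "\<delta> j" s "norm (x j - xs)"] by auto
        then have "(b - s) * norm (x j - xs) \<le> (L + b) * \<epsilon> j" by (simp add: algebra_simps)
        then have "norm (x j - xs) \<le> (L + b) / (b - s) * \<epsilon> j"
          using b by (simp add: field_simps)
        then show ?thesis using e by (simp add: M_def distrib_right)
      qed
    qed
    then show "\<exists>M>0. \<exists>N\<ge>1. \<forall>j>N. norm (x j - xs) \<le> M * \<epsilon> j"
      using fromN M(1) by blast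
  next
    assume p: "p \<ge> 2"
    obtain L where L: "\<forall>\<^sub>F j in sequentially. \<epsilon> j \<le> norm (x j - xs) \<longrightarrow>
      \<beta> / 2 * (norm (x j - xs) - \<epsilon> j) ^ p \<le> L * \<epsilon> j + \<delta> j * norm (x j - xs)"
      using key[of "\<beta> / 2"] \<beta> by auto
    obtain M where M: "M > 0"
      "\<And>r e d. 0 < e \<Longrightarrow> e \<le> 1 \<Longrightarrow> 0 < d \<Longrightarrow>
         (e \<le> r \<Longrightarrow> \<beta> / 2 * (r - e) ^ p \<le> L * e + d * r) \<Longrightarrow>
         r \<le> M * max (e powr (1 / real p)) (d powr (1 / (real p - 1)))"
      using distance_rate_of_power_inequality[OF p, of "\<beta> / 2" L] \<beta> by auto
    \<comment> \<open>The rate lemma compares \<epsilon>_j with its p-th root and therefore asks for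
      \<epsilon>_j <= 1.\<close>
    have "\<forall>\<^sub>F j in sequentially. \<epsilon> j < 1"
      using order_tendstoD(2)[OF assms(6)] by simp
    then have "\<forall>\<^sub>F j in sequentially. norm (x j - xs)
               \<le> M * max (\<epsilon> j powr (1 / real p)) (\<delta> j powr (1 / (real p - 1)))"
      using L eventually_ge_at_top[of 1]
      by eventually_elim (intro M(2), use assms(4,5) in auto)
    then show "\<exists>M>0. \<exists>N\<ge>1. \<forall>j>N. norm (x j - xs)
               \<le> M * max (\<epsilon> j powr (1 / real p)) (\<delta> j powr (1 / (real p - 1)))"
      using fromN M(1) by blast
  qed
qed

end
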